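(* Let $f\in CH(\mathbb{R})$ and let $n\in\mathbb{Z}$, $n\ge 2$. Suppose that $\mathrm{comp}(S_f)=2k+1$ for a certain $k\in\mathbb{Z}$, $k\ge 0$. Then $$\mathrm{card}(C_n(f))\le n^k .$$
   Context: $CH(\mathbb{R})$ denotes the set of characteristic functions of Borel probability measures on $\mathbb{R}$, i.e. functions $f:\mathbb{R}\to\mathbb{C}$ of the form $f(x)=\int_{\mathbb{R}}e^{itx}\,d\mu(t)$, $x\in\mathbb{R}$, with $\mu$ a Borel probability measure on $\mathbb{R}$. For $f\in CH(\mathbb{R})$ and an integer $n\ge 2$, $C_n(f)=\{g\in CH(\mathbb{R}): g(x)^n=f(x)^n \text{ for all } x\in\mathbb{R}\}$. For $f\in CH(\mathbb{R})$, $S_f=\{x\in\mathbb{R}: f(x)\ne 0\}$, which is an open subset of $\mathbb{R}$, and $\mathrm{comp}(S_f)$ denotes the number of connected components (open intervals) of $S_f$ (equal to $\infty$ if there are infinitely many). $\mathrm{card}$ denotes cardinality. *)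

theory Defs
  imports "HOL-Probability.Characteristic_Functions" "HOL-Library.Extended_Nat"
begin

definition CH :: "(real \<Rightarrow> complex) set" where
  "CH = {char M | M. real_distribution M}"

definition C_roots :: "nat \<Rightarrow> (real \<Rightarrow> complex) \<Rightarrow> (real \<Rightarrow> complex) set" where
  "C_roots n f = {g \<in> CH. \<forall>x. g x ^ n = f x ^ n}"

definition S_set :: "(real \<Rightarrow> complex) \<Rightarrow> real set" where
  "S_set f = {x. f x \<noteq> 0}"

definition num_comps :: "real set \<Rightarrow> enat" where
  "num_comps S = (if finite (components S) then enat (card (components S)) else \<infinity>)"

end

(* If g is in C_n(f), then g/f is a continuous function on S_f with values in the n-th roots of unity,
   hence constant on each component of S_f, and equal to 1 on the component of 0.
   Since g(-x) is the conjugate of g(x), the function g is determined by the constants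
   on the components contained in the positive half-line.  Reflection at 0 permutes the components
   and fixes only that of 0, so there are k such components. *)

theory Submission
  imports Defs
begin

lemma char_uminus: "char M (- t) = cnj (char M t)"
proof -
  have "char M (- t) = (CLINT x|M. cnj (iexp (t * x)))"
    unfolding char_def by (simp add: exp_cnj)
  also have "\<dots> = cnj (char M t)"
    unfolding char_def by (rule Bochner_Integration.integral_cnj)
  finally show ?thesis .
qed

lemma CH_zero: "f \<in> CH \<Longrightarrow> f 0 = 1"
  by (auto simp: CH_def real_distribution.char_zero)

lemma CH_uminus: "f \<in> CH \<Longrightarrow> f (- x) = cnj (f x)"
  by (auto simp: CH_def char_uminus)

lemma CH_continuous_on: "f \<in> CH \<Longrightarrow> continuous_on A f"
  by (auto simp: CH_def intro!: continuous_at_imp_continuous_on real_distribution.isCont_char)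

text \<open>The quotient \<open>g / h\<close> is continuous and maps \<open>T\<close> into the
  finite set of n-th roots of unity. A connected finite nonempty image is a single point, and
  evaluation at \<open>a\<close> shows that this point is 1.\<close>

lemma eq_if_powers_eq_on_connected:
  fixes g h :: "'a::topological_space \<Rightarrow> complex"
  assumes "connected T" "continuous_on T g" "continuous_on T h" "n > 0"
    and pow: "\<And>x. x \<in> T \<Longrightarrow> g x ^ n = h x ^ n"
    and nz: "\<And>x. x \<in> T \<Longrightarrow> h x \<noteq> 0"
    and "a \<in> T" "x \<in> T" "g a = h a"
  shows "g x = h x"
proof -
  let ?q = "\<lambda>x. g x / h x"
  have "connected (?q ` T)"
    using assms by (intro connected_continuous_image continuous_intros) auto
  moreover have "?q ` T \<subseteq> {z. z ^ n = 1}"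
    using pow nz by (auto simp: power_divide)
  then have "finite (?q ` T)"
    using \<open>n > 0\<close> finite_nth_roots finite_subset by blast
  ultimately obtain c where "?q ` T = {c}"
    using connected_finite_iff_sing \<open>a \<in> T\<close> by blast
  then have "?q x = ?q a"
    using \<open>a \<in> T\<close> \<open>x \<in> T\<close> by (metis imageI singletonD)
  then show ?thesis
    using nz \<open>a \<in> T\<close> \<open>x \<in> T\<close> \<open>g a = h a\<close> by (simp add: divide_eq_eq)
qed

lemma connected_real_avoiding_zero:
  fixes C :: "real set"
  assumes "connected C" "0 \<notin> C"
  shows "C \<subseteq> {0<..} \<or> C \<subseteq> {..<0}"
proof (rule ccontr)
  assume "\<not> ?thesis"
  then obtain x y where "x \<in> C" "y \<in> C" "x \<le> 0" "0 \<le> y"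
    by (auto simp: subset_eq not_less)
  then show False
    using connectedD_interval[OF \<open>connected C\<close>, of x y 0] \<open>0 \<notin> C\<close> by blast
qed

text \<open>Negation is a continuous involution that preserves \<open>S\<close>. If a connected
  \<open>D\<close> within \<open>S\<close> extends the reflection of \<open>C\<close>, then the
  reflection of \<open>D\<close> extends \<open>C\<close>, so maximality of \<open>C\<close> gives
  equality.\<close>

lemma uminus_image_components:
  fixes S :: "'a::real_normed_vector set"
  assumes sym: "uminus ` S = S" and C: "C \<in> components S"
  shows "uminus ` C \<in> components S"
proof -
  have conn: "connected (uminus ` D)" if "connected D" for D :: "'a set"
    using that by (intro connected_continuous_image continuous_intros)
  have sub: "uminus ` D \<subseteq> S" if "D \<subseteq> S" for D
    using that sym by blast
  show ?thesis
    unfolding in_components_maximal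
  proof (intro conjI allI impI)
    show "uminus ` C \<noteq> {}"
      using C in_components_nonempty by blast
    show "uminus ` C \<subseteq> S" "connected (uminus ` C)"
      by (rule sub[OF in_components_subset[OF C]], rule conn[OF in_components_connected[OF C]])
    fix D assume D: "D \<noteq> {} \<and> uminus ` C \<subseteq> D \<and> D \<subseteq> S \<and> connected D"
    have "C = uminus ` uminus ` C"
      by (simp add: image_image)
    also have "\<dots> \<subseteq> uminus ` D"
      using D by blast
    finally have "C \<subseteq> uminus ` D" .
    moreover have "uminus ` D \<noteq> {}" "uminus ` D \<subseteq> S" "connected (uminus ` D)"
      using D sub[of D] conn[of D] by simp_all
    ultimately have "uminus ` D = C"
      using C unfolding in_components_maximal by simp
    then show "D = uminus ` C"
      by (auto simp: image_image)
  qed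
qed

text \<open>Every component other than that of 0 avoids 0, hence lies in one open half-line, and
  reflection pairs off the two sides.\<close>

lemma card_components_symmetric:
  fixes S :: "real set"
  assumes sym: "uminus ` S = S" and "0 \<in> S" and fin: "finite (components S)"
  shows "card (components S) = 2 * card {C \<in> components S. C \<subseteq> {0<..}} + 1"
proof -
  let ?C0 = "connected_component_set S 0"
  let ?P = "{C \<in> components S. C \<subseteq> {0<..}}"
  let ?N = "{C \<in> components S. C \<subseteq> {..<0}}"
  have C0: "?C0 \<in> components S" "0 \<in> ?C0"
    using \<open>0 \<in> S\<close> by (auto intro: componentsI)
  have "C \<in> ?P \<union> ?N" if "C \<in> components S" "C \<noteq> ?C0" for C
    using that C0 components_nonoverlap[of C S ?C0] connected_real_avoiding_zero[of C]
      in_components_connected by blast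
  then have "components S = insert ?C0 (?P \<union> ?N)"
    using C0 by blast
  moreover have "?C0 \<notin> ?P \<union> ?N"
    using C0(2) by (auto simp del: connected_component_refl_eq)
  ultimately have "card (components S) = Suc (card (?P \<union> ?N))"
    using fin by (metis (no_types, lifting) card_insert_disjoint finite_insert)
  also have "card (?P \<union> ?N) = card ?P + card ?N"
  proof (rule card_Un_disjoint)
    show "?P \<inter> ?N = {}"
    proof (rule equals0I)
      fix C assume "C \<in> ?P \<inter> ?N"
      \<comment> \<open>Nonemptiness is essential: the empty set lies in both half-lines.\<close>
      then have "C \<noteq> {}" "C \<subseteq> {0<..}" "C \<subseteq> {..<0}"
        using in_components_nonempty by auto
      then show False
        by force
    qed
  qed (use fin in auto)
  also have "card ?N = card ?P"
  proof (rule bij_betw_same_card[of "image uminus"])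
    show "bij_betw (image uminus) ?N ?P"
      \<comment> \<open>Reflection is its own inverse.\<close>
      by (rule bij_betw_byWitness[where f' = "image uminus"])
        (auto simp: image_image intro: uminus_image_components[OF sym])
  qed
  finally show ?thesis
    by simp
qed

theorem proposition1p2:
  fixes f :: "real \<Rightarrow> complex" and n k :: nat
  assumes "f \<in> CH"
    and "n \<ge> 2"
    and "num_comps (S_set f) = enat (2 * k + 1)"
  shows "finite (C_roots n f) \<and> card (C_roots n f) \<le> n ^ k"
proof -
  define S where "S = S_set f"
  define P where "P = {C \<in> components S. C \<subseteq> {0<..}}"
  define pick :: "real set \<Rightarrow> real" where "pick C = (SOME x. x \<in> C)" for C
  \<comment> \<open>\<open>\<Phi>\<close> samples \<open>g\<close> at one point of each positive
    component. The restriction fixes the value off \<open>P\<close>, so that \<open>\<Phi> g\<close>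
    belongs to the extensional product \<open>R\<close>.\<close>
  define \<Phi> where "\<Phi> g = restrict (g \<circ> pick) P" for g :: "real \<Rightarrow> complex"
  define R where "R = (\<Pi>\<^sub>E C\<in>P. {z. z ^ n = f (pick C) ^ n})"
  have n: "n > 0"
    using \<open>n \<ge> 2\<close> by simp
  have fin: "finite (components S)" and card: "card (components S) = 2 * k + 1"
    using assms(3) by (auto simp: S_def num_comps_def split: if_splits)
  have zero: "0 \<in> S"
    using CH_zero[OF \<open>f \<in> CH\<close>] by (simp add: S_def S_set_def)
  have minus: "- x \<in> S" if "x \<in> S" for x
    using that CH_uminus[OF \<open>f \<in> CH\<close>] by (simp add: S_def S_set_def)
  then have sym: "uminus ` S = S"
    by (force simp: image_iff)
  have "card P = k"
    using card_components_symmetric[OF sym zero fin] card by (simp add: P_def)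
  have "finite P"
    using fin by (simp add: P_def)
  have pick: "pick C \<in> C" if "C \<in> components S" for C
    using in_components_nonempty[OF that] by (simp add: pick_def some_in_eq)
  \<comment> \<open>Each factor of \<open>R\<close> has exactly \<open>n\<close> elements because a
    nonzero number has \<open>n\<close> distinct n-th roots.\<close>
  have pick_S: "f (pick C) \<noteq> 0" if "C \<in> P" for C
    using pick that in_components_subset by (auto simp: P_def S_def S_set_def)
  have "finite R"
    unfolding R_def using n \<open>finite P\<close> by (intro finite_PiE) auto
  have "card R = n ^ k"
    unfolding R_def using \<open>finite P\<close> \<open>card P = k\<close> n pick_S
    by (simp add: card_PiE card_nth_roots)
  have eq_on_comp: "g x = h x"
    if "g \<in> C_roots n f" "h \<in> C_roots n f" "C \<in> components S" "a \<in> C" "x \<in> C" "g a = h a"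
    for g h C a x
  proof (rule eq_if_powers_eq_on_connected[of C g h n])
    \<comment> \<open>Equality of n-th powers gives \<open>h\<close> the same zeros as
      \<open>f\<close>.\<close>
    show "h y \<noteq> 0" if "y \<in> C" for y
    proof -
      have "f y \<noteq> 0"
        using \<open>C \<in> components S\<close> \<open>y \<in> C\<close> in_components_subset by (auto simp: S_def S_set_def)
      moreover have "h y ^ n = f y ^ n"
        using \<open>h \<in> C_roots n f\<close> by (simp add: C_roots_def)
      ultimately show ?thesis
        using n by (metis power_eq_0_iff)
    qed
  qed (use that n in \<open>auto simp: C_roots_def CH_continuous_on in_components_connected\<close>)
  have "inj_on \<Phi> (C_roots n f)"
  proof (rule inj_onI)
    fix g h assume g: "g \<in> C_roots n f" and h: "h \<in> C_roots n f" and eq: "\<Phi> g = \<Phi> h"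
    have CH: "g \<in> CH" "h \<in> CH"
      using g h by (auto simp: C_roots_def)
    have nonneg: "g x = h x" if "x \<in> S" "x \<ge> 0" for x
    proof -
      let ?C = "connected_component_set S x"
      have C: "?C \<in> components S" "x \<in> ?C"
        using \<open>x \<in> S\<close> by (auto intro: componentsI)
      show ?thesis
      proof (cases "0 \<in> ?C")
        \<comment> \<open>No sample is taken on the component of 0: there both functions are
          normalized to 1 at 0.\<close>
        case True
        then show ?thesis
          using eq_on_comp[OF g h C(1) True C(2)] CH by (simp add: CH_zero)
      next
        case False
        \<comment> \<open>The negative half-line is excluded since \<open>x\<close> lies in the
          component and \<open>x \<ge> 0\<close>.\<close>
        then have "?C \<subseteq> {0<..}"
          using connected_real_avoiding_zero[of ?C] C(2) \<open>x \<ge> 0\<close>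
          by (metis connected_connected_component lessThan_iff not_less subsetD)
        then have "?C \<in> P"
          using C by (simp add: P_def)
        then have "g (pick ?C) = h (pick ?C)"
          using fun_cong[OF eq, of ?C] by (simp add: \<Phi>_def)
        then show ?thesis
          using eq_on_comp[OF g h C(1) pick[OF C(1)] C(2)] by simp
      qed
    qed
    show "g = h"
    proof
      fix x
      consider "x \<notin> S" | "x \<in> S" "x \<ge> 0" | "x \<in> S" "x \<le> 0"
        by linarith
      then show "g x = h x"
      proof cases
        case 1
        then have "g x ^ n = 0" "h x ^ n = 0"
          using g h n by (auto simp: C_roots_def S_def S_set_def)
        then show ?thesis
          by simp
      next
        case 2
        then show ?thesis
          by (rule nonneg)
      next
        case 3
        \<comment> \<open>The reflected point is nonnegative and in \<open>S\<close>; conjugation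
          carries the equality back to \<open>x\<close>.\<close>
        then have "g (- x) = h (- x)"
          by (intro nonneg minus) auto
        then show ?thesis
          using CH by (simp add: CH_uminus)
      qed
    qed
  qed
  moreover have "\<Phi> ` C_roots n f \<subseteq> R"
    by (auto simp: \<Phi>_def R_def C_roots_def)
  \<comment> \<open>Injectivity into the finite set \<open>R\<close> yields finiteness as well as
    the bound; this matters because \<open>card\<close> of an infinite set is 0.\<close>
  ultimately show ?thesis
    using \<open>finite R\<close> \<open>card R = n ^ k\<close> card_inj_on_le inj_on_finite by metis
qed

end
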